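(* Consider the censored delayed-feedback bandit model with threshold $m\ge1$ (see context), with arm $1$ the unique optimal arm, $\theta_1<1$, $\Delta_k=\theta_1-\theta_k>0$ for $k\neq1$, and $\tau_m>0$. Let $\epsilon>0$ and run DelayedKLUCB with exploration function $\beta_\epsilon(t)=(1+\epsilon)\log t$. Then for any $\eta>0$, \[ L(T)\le(1+\eta)\frac{(1+\epsilon)\log T}{1-\theta_1}\sum_{k\neq1}\frac{\tau_m\Delta_k}{d(\tau_m\theta_k,\tau_m\theta_1)}+o(\log T), \] where the $o(\log T)$ term (which may depend on $\epsilon,m,\eta,\theta$ and the delay distribution) divided by $\log T$ tends to $0$ as $T\to\infty$.
   Context: Censored delayed-feedback bandit model: $K$ arms with unknown conversion rates $\theta_1,\dots,\theta_K\in[0,1]$; a known delay distribution on $\mathbb{N}$ with CDF $\tau_d=\mathbb{P}(D\le d)$; a threshold $m\ge1$. At each round $t$ the learner picks $A_t$ based on past observations; this triggers, conditionally independently given the past, $C_t\sim\mathrm{Bernoulli}(\theta_{A_t})$ and $D_t\sim\tau$. With $X_{s,t}=C_s\mathbf{1}\{D_s\le t-s\}$, at round $t$ the learner observes $X_{s,t}$ for $t-m\le s\le t$ and receives $Y_t=\sum_{s=t-m}^tC_s\mathbf{1}\{D_s=t-s\}$. Expected regret $L(T)=\mathbb{E}[r^*(T)-r(T)]$, $r(T)=\sum_{t\le T}Y_t$, $r^*(T)$ the reward of the oracle always playing arm $1$. Estimators: $\tilde N_k(t)=\tau_m\sum_{s=1}^{t-m}\mathbf{1}\{A_s=k\}+\sum_{s=t-m+1}^{t-1}\mathbf{1}\{A_s=k\}\tau_{t-s}$;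 $S_k(t)=\sum_{s=1}^{t-1}\mathbf{1}\{A_s=k\}C_s\mathbf{1}\{D_s\le\min(t-s,m)\}$; $\hat\theta_k(t)=S_k(t)/\tilde N_k(t)$. $d(p,q)=p\log(p/q)+(1-p)\log((1-p)/(1-q))$ (Bernoulli KL divergence); $d_{\mathrm{Pois}}(p,q)=p\log(p/q)+q-p$ (Poisson KL divergence). DelayedKLUCB: play each arm once in the first $K$ rounds; for $t>K$ play $A_t\in\arg\max_kU_k(t)$ with $U_k(t)=\max\{q\in[\hat\theta_k(t),1]:\tilde N_k(t)\,d_{\mathrm{Pois}}(\hat\theta_k(t),q)\le\beta_\epsilon(t)\}$.
   Formalization: When the estimate of an arm exceeds 1, which happens with positive probability, the interval in the definition of its index is empty and the maximum undefined; the index is then taken to be the estimate itself. The first K rounds play the arms in the order 1,...,K. *)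

theory Defs
  imports "HOL-Probability.Probability" "HOL-Library.Landau_Symbols"
begin

text \<open>A history of length n records rounds 1..n; entry number s-1 is the
triple (A_s, C_s, D_s). The learner is a function of the history.\<close>

type_synonym hist = "(nat \<times> bool \<times> nat) list"

definition arm_of :: "hist \<Rightarrow> nat \<Rightarrow> nat" where
  "arm_of h s = fst (h ! (s - 1))"

definition conv_of :: "hist \<Rightarrow> nat \<Rightarrow> bool" where
  "conv_of h s = fst (snd (h ! (s - 1)))"

definition delay_of :: "hist \<Rightarrow> nat \<Rightarrow> nat" where
  "delay_of h s = snd (snd (h ! (s - 1)))"

primrec run_pmf :: "(nat \<Rightarrow> real) \<Rightarrow> nat pmf \<Rightarrow> (hist \<Rightarrow> nat) \<Rightarrow> nat \<Rightarrow> hist pmf" where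
  "run_pmf \<theta> delay pol 0 = return_pmf []"
| "run_pmf \<theta> delay pol (Suc n) =
     bind_pmf (run_pmf \<theta> delay pol n) (\<lambda>h.
     bind_pmf (bernoulli_pmf (\<theta> (pol h))) (\<lambda>c.
     bind_pmf delay (\<lambda>d.
     return_pmf (h @ [(pol h, c, d)]))))"

definition tau :: "nat pmf \<Rightarrow> nat \<Rightarrow> real" where
  "tau delay d = measure_pmf.prob delay {..d}"

definition Y :: "nat \<Rightarrow> hist \<Rightarrow> nat \<Rightarrow> real" where
  "Y m h t = (\<Sum>s\<in>{t - m..t}. if 1 \<le> s \<and> conv_of h s \<and> delay_of h s = t - s then 1 else 0)"

definition cum_reward :: "nat \<Rightarrow> hist \<Rightarrow> nat \<Rightarrow> real" where
  "cum_reward m h T = (\<Sum>t\<in>{1..T}. Y m h t)"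

definition expected_reward :: "(nat \<Rightarrow> real) \<Rightarrow> nat pmf \<Rightarrow> nat \<Rightarrow> (hist \<Rightarrow> nat) \<Rightarrow> nat \<Rightarrow> real" where
  "expected_reward \<theta> delay m pol T =
     measure_pmf.expectation (run_pmf \<theta> delay pol T) (\<lambda>h. cum_reward m h T)"

definition regret :: "(nat \<Rightarrow> real) \<Rightarrow> nat pmf \<Rightarrow> nat \<Rightarrow> (hist \<Rightarrow> nat) \<Rightarrow> nat \<Rightarrow> real" where
  "regret \<theta> delay m pol T =
     expected_reward \<theta> delay m (\<lambda>_. 1) T - expected_reward \<theta> delay m pol T"

definition Ntilde :: "nat pmf \<Rightarrow> nat \<Rightarrow> hist \<Rightarrow> nat \<Rightarrow> real" where
  "Ntilde delay m h k = (let t = length h + 1 in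
     tau delay m * (\<Sum>s\<in>{1..t - m}. if arm_of h s = k then 1 else 0)
     + (\<Sum>s\<in>{t - m + 1..t - 1}. if arm_of h s = k then tau delay (t - s) else 0))"

definition Sk :: "nat \<Rightarrow> hist \<Rightarrow> nat \<Rightarrow> real" where
  "Sk m h k = (let t = length h + 1 in
     (\<Sum>s\<in>{1..t - 1}. if arm_of h s = k \<and> conv_of h s \<and> delay_of h s \<le> min (t - s) m
                       then 1 else 0))"

definition theta_hat :: "nat pmf \<Rightarrow> nat \<Rightarrow> hist \<Rightarrow> nat \<Rightarrow> real" where
  "theta_hat delay m h k = Sk m h k / Ntilde delay m h k"

definition d_bern :: "real \<Rightarrow> real \<Rightarrow> real" where
  "d_bern p q = p * ln (p / q) + (1 - p) * ln ((1 - p) / (1 - q))"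

definition d_pois :: "real \<Rightarrow> real \<Rightarrow> real" where
  "d_pois p q = p * ln (p / q) + q - p"

text \<open>U_k(t) = max{q \<in> [theta_hat, 1] : Ntilde * d_pois(theta_hat, q) \<le> beta(t)},
with beta(t) = (1+eps) log t. If theta_hat > 1 the set is empty; we then use
theta_hat itself as index (convention).\<close>
definition ucb_index :: "real \<Rightarrow> nat pmf \<Rightarrow> nat \<Rightarrow> hist \<Rightarrow> nat \<Rightarrow> real" where
  "ucb_index \<epsilon> delay m h k = (let t = length h + 1; p = theta_hat delay m h k;
      \<beta> = (1 + \<epsilon>) * ln (real t) in
     if p \<le> 1 then Sup {q. p \<le> q \<and> q \<le> 1 \<and> Ntilde delay m h k * d_pois p q \<le> \<beta>}
     else p)"

definition is_DelayedKLUCB :: "nat \<Rightarrow> real \<Rightarrow> nat pmf \<Rightarrow> nat \<Rightarrow> (hist \<Rightarrow> nat) \<Rightarrow> bool" where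
  "is_DelayedKLUCB K \<epsilon> delay m pol \<longleftrightarrow>
     (\<forall>h. (length h < K \<longrightarrow> pol h = length h + 1) \<and>
          (K \<le> length h \<longrightarrow> pol h \<in> {1..K} \<and>
             (\<forall>j\<in>{1..K}. ucb_index \<epsilon> delay m h j \<le> ucb_index \<epsilon> delay m h (pol h))))"

end

theory Submission
  imports Defs "HOL-Real_Asymp.Real_Asymp"
begin

text \<open>A round's missed reward is at most \<open>\<tau>\<^sub>m\<close> times the gap of the arm played, so it suffices
  to bound the expected number of pulls of each suboptimal arm \<open>k\<close>. Because
  \<open>1 + p (e\<^sup>l - 1) \<le> exp (p (e\<^sup>l - 1))\<close>, for every choice of delay caps that is fixed in advance
  \<open>exp (l S - \<theta> (e\<^sup>l - 1) N)\<close> is a supermartingale, where \<open>S\<close> counts the conversions within the caps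
  and \<open>N\<close> is the corresponding exposure.

  With the caps seen at a fixed time \<open>t\<close>, these are the estimators of the algorithm. If the index of
  arm 1 is below some \<open>\<mu> < \<theta>\<^sub>1\<close>, then by Fenchel duality and compactness one of finitely many such
  exponentials exceeds \<open>t\<^bsup>1+\<epsilon>\<^esup>\<close>; by Markov's inequality these probabilities are summable.
  If arm \<open>k\<close> is played with index at least \<open>\<mu>\<close>, either \<open>N d(p, \<mu>) \<le> (1 + \<epsilon>) log t\<close> for a \<open>p\<close> slightly
  above \<open>\<theta>\<^sub>k\<close>, which yields the main term, or its estimate exceeds \<open>p\<close>. For the latter case all
  caps are \<open>m\<close> and the supermartingale is discounted by \<open>e\<^sup>-\<^sup>c\<close> per pull of \<open>k\<close>: it loses a fixed
  fraction of its value at each pull, so the expected number of such rounds is bounded. The Poisson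
  divergence is turned into the Bernoulli one by \<open>(1 - q) d_bern p q \<le> d_pois p q\<close>.\<close>

section \<open>Poisson and Bernoulli divergences\<close>

lemma ln_less_minus_one:
  fixes x :: real
  assumes "0 < x" "x \<noteq> 1"
  shows "ln x < x - 1"
  using ln_le_minus_one[of x] ln_eq_minus_one[of x] assms by fastforce

text \<open>Follows from \<open>ln y \<le> y - 1\<close> at \<open>y = q * exp l / x\<close>. The
  subtracted term is the log moment generating function of a Poisson variable of mean
  \<open>q\<close>, so the bound is linear in \<open>x\<close> and in \<open>q\<close>
  separately.\<close>

lemma d_pois_fenchel:
  assumes "0 \<le> x" "0 < q"
  shows "l * x - q * (exp l - 1) \<le> d_pois x q"
proof (cases "x = 0")
  case True
  then show ?thesis using assms by (simp add: d_pois_def algebra_simps)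
next
  case False
  with assms have x: "0 < x" by simp
  have "ln (q * exp l / x) \<le> q * exp l / x - 1"
    using x assms by (intro ln_le_minus_one) auto
  then have "ln q + l - ln x \<le> q * exp l / x - 1"
    using x assms by (simp add: ln_div ln_mult)
  then have "x * (ln q + l - ln x) \<le> x * (q * exp l / x - 1)"
    using x by (intro mult_left_mono) auto
  then show ?thesis using x assms by (simp add: d_pois_def ln_div algebra_simps)
qed

lemma d_pois_fenchel_eq:
  assumes "0 < x" "0 < q"
  shows "ln (x / q) * x - q * (exp (ln (x / q)) - 1) = d_pois x q"
  using assms by (simp add: d_pois_def field_simps)

text \<open>For \<open>x > 0\<close> the supremum over \<open>l\<close> is attained at
  \<open>ln (x / q)\<close>. At \<open>x = 0\<close> it is only approached as \<open>l\<close> tends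
  to minus infinity, hence the strict bound \<open>c\<close>.\<close>

lemma d_pois_fenchel_approx:
  assumes "0 \<le> x" "x < q" "c < d_pois x q"
  obtains l where "c < l * x - q * (exp l - 1)"
proof (cases "x = 0")
  case True
  have "((\<lambda>l. - q * (exp l - 1)) \<longlongrightarrow> - q * (0 - 1)) at_bot"
    by (intro tendsto_intros exp_at_bot)
  moreover have "c < - q * (0 - 1)" using assms True by (simp add: d_pois_def)
  ultimately have "eventually (\<lambda>l::real. c < - q * (exp l - 1)) at_bot"
    by (rule order_tendstoD)
  then obtain l :: real where "c < - q * (exp l - 1)"
    using eventually_happens' trivial_limit_at_bot_linorder by blast
  then show ?thesis using True that[of l] by simp
next
  case False
  then show ?thesis using assms d_pois_fenchel_eq[of x q] that[of "ln (x / q)"] by simp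
qed

text \<open>The optimal \<open>l\<close> for \<open>q'\<close> is non-positive, so replacing
  \<open>q'\<close> by the larger \<open>q\<close> can only raise the linear form, which stays below
  \<open>d_pois p q\<close>.\<close>

lemma d_pois_mono_right:
  assumes "0 \<le> p" "p \<le> q'" "q' \<le> q" "0 < q'"
  shows "d_pois p q' \<le> d_pois p q"
proof (cases "p = 0")
  case True
  then show ?thesis using assms by (simp add: d_pois_def)
next
  case False
  with assms have p: "0 < p" by simp
  have "d_pois p q' = ln (p / q') * p - q' * (exp (ln (p / q')) - 1)"
    using p assms by (intro d_pois_fenchel_eq[symmetric]) auto
  also have "\<dots> \<le> ln (p / q') * p - q * (exp (ln (p / q')) - 1)"
    using p assms by (simp add: mult_right_mono_neg)
  also have "\<dots> \<le> d_pois p q"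
    using assms by (intro d_pois_fenchel) auto
  finally show ?thesis .
qed

text \<open>Same device in the other argument: the optimal \<open>l\<close> for \<open>p'\<close> is
  non-positive, and it is the slope in \<open>p\<close>.\<close>

lemma d_pois_antimono_left:
  assumes "0 \<le> p" "p \<le> p'" "p' \<le> q" "0 < p'"
  shows "d_pois p' q \<le> d_pois p q"
proof -
  have l: "ln (p' / q) \<le> 0" using assms by simp
  have "d_pois p' q = ln (p' / q) * p' - q * (exp (ln (p' / q)) - 1)"
    using assms by (intro d_pois_fenchel_eq[symmetric]) auto
  also have "\<dots> \<le> ln (p' / q) * p - q * (exp (ln (p' / q)) - 1)"
    using l assms by (simp add: mult_left_mono_neg)
  also have "\<dots> \<le> d_pois p q"
    using assms by (intro d_pois_fenchel) auto
  finally show ?thesis .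
qed

lemma d_pois_pos:
  assumes "0 \<le> p" "p < q"
  shows "0 < d_pois p q"
proof (cases "p = 0")
  case True
  then show ?thesis using assms by (simp add: d_pois_def)
next
  case False
  with assms have "ln (q / p) < q / p - 1"
    using ln_less_minus_one[of "q / p"]  by (simp add: field_simps)
  then have "p * ln (q / p) < p * (q / p - 1)"
    using False assms by (intro mult_strict_left_mono) auto
  then show ?thesis using False assms by (simp add: d_pois_def ln_div algebra_simps)
qed

text \<open>The difference of the two sides is affine and non-increasing in \<open>x\<close>; at the
  endpoint \<open>x = \<mu>\<close> it equals \<open>d_pois \<mu> q\<close>, which is
  positive.\<close>

lemma d_pois_less_right:
  assumes "0 \<le> x" "x \<le> \<mu>" "\<mu> < q" "0 < \<mu>"
  shows "d_pois x \<mu> < d_pois x q"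
proof -
  have ln_le: "ln (\<mu> / q) \<le> 0" using assms by simp
  have "d_pois x q - d_pois x \<mu> = x * ln (\<mu> / q) + q - \<mu>"
    using assms by (cases "x = 0") (simp_all add: d_pois_def ln_div algebra_simps)
  also have "\<dots> \<ge> \<mu> * ln (\<mu> / q) + q - \<mu>"
    using ln_le assms by (simp add: mult_right_mono_neg)
  also have "\<mu> * ln (\<mu> / q) + q - \<mu> = d_pois \<mu> q" by (simp add: d_pois_def)
  finally show ?thesis using d_pois_pos[of \<mu> q] assms by linarith
qed

lemma d_pois_scale:
  assumes "0 < t" shows "d_pois (t * p) (t * q) = t * d_pois p q"
  using assms by (simp add: d_pois_def algebra_simps)

lemma continuous_on_x_ln: "continuous_on {0..} (\<lambda>x::real. x * ln x)"
  unfolding continuous_on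
proof
  fix x :: real assume x: "x \<in> {0..}"
  show "((\<lambda>x. x * ln x) \<longlongrightarrow> x * ln x) (at x within {0..})"
  proof (cases "x = 0")
    case True
    have "((\<lambda>x::real. x * ln x) \<longlongrightarrow> 0) (at_right 0)" by real_asymp
    then show ?thesis using True
      by (simp add: at_within_Ici_at_right)
  next
    case False
    then show ?thesis by (intro tendsto_intros) auto
  qed
qed

lemma continuous_on_d_pois:
  assumes "0 < q" shows "continuous_on {0..} (\<lambda>x. d_pois x q)"
proof -
  have "continuous_on {0..} (\<lambda>x::real. x * ln x - x * ln q + q - x)"
    by (intro continuous_intros continuous_on_x_ln)
  moreover have "d_pois x q = x * ln x - x * ln q + q - x" if "x \<in> {0..}" for x
    using that assms by (cases "x = 0") (auto simp: d_pois_def ln_div algebra_simps)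
  ultimately show ?thesis by (subst continuous_on_cong[OF refl]) auto
qed

text \<open>The gap \<open>\<mu> < q\<close> makes some \<open>l\<close> work strictly at each
  \<open>x\<close>, hence on a relatively open set, and compactness of \<open>{0..\<mu>}\<close>
  leaves finitely many. A random estimate can then be handled by a union bound over deterministic
  \<open>l\<close>.\<close>

lemma d_pois_finite_fenchel_cover:
  assumes "0 < \<mu>" "\<mu> < q"
  obtains L where "finite L"
    "\<And>x. 0 \<le> x \<Longrightarrow> x \<le> \<mu> \<Longrightarrow> \<exists>l\<in>L. d_pois x \<mu> \<le> l * x - q * (exp l - 1)"
proof -
  define g where "g = (\<lambda>l x. l * x - q * (exp l - 1) - d_pois x \<mu>)"
  define U where "U = (\<lambda>l. {0..\<mu>} \<inter> g l -` {0<..})"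
  have cont: "continuous_on {0..\<mu>} (g l)" for l
    unfolding g_def using assms
    by (intro continuous_intros continuous_on_subset[OF continuous_on_d_pois]) auto
  have op: "openin (top_of_set {0..\<mu>}) (U l)" for l
    unfolding U_def by (intro continuous_openin_preimage_gen cont open_greaterThan)
  have cov: "{0..\<mu>} \<subseteq> \<Union>(range U)"
  proof
    fix x assume x: "x \<in> {0..\<mu>}"
    then have "d_pois x \<mu> < d_pois x q" using assms by (intro d_pois_less_right) auto
    then obtain l where "d_pois x \<mu> < l * x - q * (exp l - 1)"
      using d_pois_fenchel_approx[of x q "d_pois x \<mu>"] x assms by auto
    then show "x \<in> \<Union>(range U)" using x by (auto simp: U_def g_def)
  qed
  obtain D where "D \<subseteq> range U" "finite D" "{0..\<mu>} \<subseteq> \<Union>D"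
    using op cov compact_Icc[of 0 \<mu>] unfolding compact_eq_openin_cover
    by (metis (no_types, lifting) imageE)
  then obtain L where L: "finite L" "{0..\<mu>} \<subseteq> \<Union>(U ` L)"
    by (metis finite_subset_image)
  show ?thesis
  proof (rule that)
    fix x assume "0 \<le> x" "x \<le> \<mu>"
    then have "x \<in> \<Union>(U ` L)" using L by auto
    then show "\<exists>l\<in>L. d_pois x \<mu> \<le> l * x - q * (exp l - 1)"
      by (force simp: U_def g_def)
  qed (use L in auto)
qed

text \<open>A single near-optimal \<open>l\<close> gives a lower bound that is continuous in both
  arguments, so both may be moved a little inwards. This margin is later paid for by the factor
  \<open>1 + \<eta>\<close>.\<close>

lemma d_pois_lower_semicontinuous:
  assumes "0 \<le> p" "p < q" "c < d_pois p q"
  obtains p' \<mu> where "p < p'" "p' < \<mu>" "\<mu> < q" "c < d_pois p' \<mu>"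
proof -
  obtain l where l: "c < l * p - q * (exp l - 1)"
    using d_pois_fenchel_approx[of p q c] assms by auto
  define b where "b = (\<lambda>e. l * (p + e) - (q - e) * (exp l - 1))"
  have "(b \<longlongrightarrow> b 0) (at_right 0)" unfolding b_def by (intro tendsto_intros)
  then have "eventually (\<lambda>e. c < b e) (at_right 0)"
    using l by (intro order_tendstoD) (auto simp: b_def)
  moreover have "eventually (\<lambda>e. e \<in> {0<..<(q - p) / 3}) (at_right 0)"
    using assms by (intro eventually_at_right_real) auto
  ultimately have "eventually (\<lambda>e. c < b e \<and> e \<in> {0<..<(q - p) / 3}) (at_right 0)"
    by eventually_elim simp
  then obtain e where e: "c < b e" "0 < e" "e < (q - p) / 3"
    using eventually_happens' trivial_limit_at_right_real by fastforce
  have "b e \<le> d_pois (p + e) (q - e)"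
    unfolding b_def using e assms by (intro d_pois_fenchel) auto
  then show ?thesis using e assms by (intro that[of "p + e" "q - e"]) (auto simp: field_simps)
qed

lemma d_bern_le_d_pois:
  assumes "0 \<le> p" "p < q" "q < 1"
  shows "(1 - q) * d_bern p q \<le> d_pois p q"
proof -
  define g where "g = (\<lambda>x. (p * ln p - p * ln x + x - p)
     - (1 - q) * (p * ln p - p * ln x + (1 - p) * ln (1 - p) - (1 - p) * ln (1 - x)))"
  define g' where "g' = (\<lambda>x. (- p / x + 1) - (1 - q) * (- p / x + (1 - p) / (1 - x)))"
  have deriv: "(g has_real_derivative g' x) (at x)" if "0 < x" "x < 1" for x
    unfolding g_def g'_def using that
    by (auto intro!: derivative_eq_intros simp: divide_simps) (simp add: algebra_simps)
  have nonneg: "0 \<le> g' x" if "0 < x" "p \<le> x" "x \<le> q" for x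
  proof -
    have "g' x = (x - p) / x * (1 - (1 - q) / (1 - x))"
      using that assms by (simp add: g'_def field_simps)
    then show ?thesis using that assms by (auto intro!: mult_nonneg_nonneg)
  qed
  have eq: "d_pois p q - (1 - q) * d_bern p q = g q"
    using assms by (cases "p = 0") (simp_all add: g_def d_pois_def d_bern_def ln_div algebra_simps)
  have "0 \<le> g q"
  proof (cases "p = 0")
    case True
    have "ln (1 / (1 - q)) \<le> 1 / (1 - q) - 1" using assms by (intro ln_le_minus_one) auto
    then have "(1 - q) * ln (1 / (1 - q)) \<le> (1 - q) * (1 / (1 - q) - 1)"
      using assms by (intro mult_left_mono) auto
    then show ?thesis using True assms by (simp add: g_def ln_div algebra_simps)
  next
    case False
    then have "g p \<le> g q"
      using assms deriv nonneg
      by (intro DERIV_nonneg_imp_nondecreasing[of p q g]) (auto intro!: exI[of _ "g' _"])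
    then show ?thesis by (simp add: g_def)
  qed
  then show ?thesis using eq by linarith
qed

text \<open>The second summand of \<open>d_bern\<close> exceeds \<open>q - p\<close>, so
  \<open>d_bern p q\<close> exceeds \<open>d_pois p q\<close>.\<close>

lemma d_bern_pos:
  assumes "0 \<le> p" "p < q" "q < 1"
  shows "0 < d_bern p q"
proof -
  have "ln ((1 - q) / (1 - p)) < (1 - q) / (1 - p) - 1"
    using ln_less_minus_one[of "(1 - q) / (1 - p)"] assms by (simp add: field_simps)
  then have "(1 - p) * ln ((1 - q) / (1 - p)) < (1 - p) * ((1 - q) / (1 - p) - 1)"
    using assms by (intro mult_strict_left_mono) auto
  also have "(1 - p) * ((1 - q) / (1 - p) - 1) = p - q"
    using assms by (simp add: field_simps)
  finally have "q - p < (1 - p) * ln ((1 - p) / (1 - q))"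
    using assms by (simp add: ln_div algebra_simps)
  then show ?thesis using d_pois_pos[of p q] assms by (simp add: d_bern_def d_pois_def)
qed

section \<open>Expectations over histories\<close>

text \<open>Setting \<open>f\<close> to zero off the support turns a bound on the support into a
  global one, under which the expectations may be iterated.\<close>

lemma integral_bind_pmf_bounded:
  fixes f :: "'a \<Rightarrow> real"
  assumes "\<And>y. y \<in> set_pmf (bind_pmf p q) \<Longrightarrow> \<bar>f y\<bar> \<le> B"
  shows "measure_pmf.expectation (bind_pmf p q) f =
    measure_pmf.expectation p (\<lambda>x. measure_pmf.expectation (q x) f)"
proof -
  define g where "g = (\<lambda>y. if y \<in> set_pmf (bind_pmf p q) then f y else 0)"
  have B: "norm (g y) \<le> \<bar>B\<bar>" for y using assms by (fastforce simp: g_def)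
  have "measure_pmf.expectation (bind_pmf p q) f = measure_pmf.expectation (bind_pmf p q) g"
    by (intro integral_cong_AE) (auto simp: AE_measure_pmf_iff g_def)
  also have "\<dots> = measure_pmf.expectation p (\<lambda>x. measure_pmf.expectation (q x) g)"
    unfolding measure_pmf_bind
    by (rule integral_bind[where K = "count_space UNIV" and B' = 1 and B = "\<bar>B\<bar>"])
      (use B in \<open>auto simp: measure_pmf.emeasure_eq_measure measure_pmf_in_subprob_algebra
         measure_pmf_in_subprob_space\<close>)
  also have "\<dots> = measure_pmf.expectation p (\<lambda>x. measure_pmf.expectation (q x) f)"
  proof (intro integral_cong_AE)
    show "AE x in measure_pmf p. measure_pmf.expectation (q x) g = measure_pmf.expectation (q x) f"
      by (auto simp: AE_measure_pmf_iff g_def intro!: integral_cong_AE)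
  qed auto
  finally show ?thesis .
qed

lemma integrable_measure_pmf_bounded:
  fixes f :: "'a \<Rightarrow> real"
  assumes "\<And>y. y \<in> set_pmf p \<Longrightarrow> \<bar>f y\<bar> \<le> B"
  shows "integrable (measure_pmf p) f"
  using assms by (intro measure_pmf.integrable_const_bound[where B = B]) (auto simp: AE_measure_pmf_iff)

lemma length_run_pmf: "h \<in> set_pmf (run_pmf \<theta> delay pol n) \<Longrightarrow> length h = n"
  by (induction n arbitrary: h) auto

text \<open>The statistics below grow with the history but are bounded at each fixed length. As
  \<open>run_pmf\<close> after \<open>n\<close> rounds is supported on histories of length
  \<open>n\<close>, this suffices for integrability.\<close>

definition bounded_at :: "nat \<Rightarrow> (hist \<Rightarrow> real) \<Rightarrow> bool" where
  "bounded_at n F \<longleftrightarrow> (\<exists>B. \<forall>h. length h = n \<longrightarrow> \<bar>F h\<bar> \<le> B)"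

lemma bounded_atI: "(\<And>h. length h = n \<Longrightarrow> \<bar>F h\<bar> \<le> B) \<Longrightarrow> bounded_at n F"
  by (auto simp: bounded_at_def)

lemma bounded_at_add: 
  assumes "bounded_at n F" "bounded_at n G" shows "bounded_at n (\<lambda>h. F h + G h)"
proof -
  obtain A B where "\<forall>h. length h = n \<longrightarrow> \<bar>F h\<bar> \<le> A" "\<forall>h. length h = n \<longrightarrow> \<bar>G h\<bar> \<le> B"
    using assms by (auto simp: bounded_at_def)
  then show ?thesis by (intro bounded_atI[where B = "A + B"]) (fastforce intro: order_trans[OF abs_triangle_ineq] add_mono)
qed

lemma bounded_at_mult: 
  assumes "bounded_at n F" "bounded_at n G" shows "bounded_at n (\<lambda>h. F h * G h)"
proof -
  obtain A B where "\<forall>h. length h = n \<longrightarrow> \<bar>F h\<bar> \<le> A" "\<forall>h. length h = n \<longrightarrow> \<bar>G h\<bar> \<le> B"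
    using assms by (auto simp: bounded_at_def)
  then show ?thesis
    by (intro bounded_atI[where B = "A * B"]) (auto simp: abs_mult intro!: mult_mono elim: order_trans[OF abs_ge_zero])
qed

lemma bounded_at_const: "bounded_at n (\<lambda>_. c)"
  by (auto simp: bounded_at_def)

lemma bounded_at_cmult: "bounded_at n F \<Longrightarrow> bounded_at n (\<lambda>h. c * F h)"
  by (intro bounded_at_mult bounded_at_const)

lemma bounded_at_of_bool: "bounded_at n (\<lambda>h. of_bool (P h))"
  by (intro bounded_atI[where B = 1]) auto

lemma bounded_at_minus: "bounded_at n F \<Longrightarrow> bounded_at n (\<lambda>h. - F h)"
  by (simp add: bounded_at_def)

lemma bounded_at_diff: "bounded_at n F \<Longrightarrow> bounded_at n G \<Longrightarrow> bounded_at n (\<lambda>h. F h - G h)"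
  using bounded_at_add[of n F "\<lambda>h. - G h"] bounded_at_minus[of n G] by simp

lemma bounded_at_sum: 
  "(\<And>i. i \<in> I \<Longrightarrow> bounded_at n (F i)) \<Longrightarrow> bounded_at n (\<lambda>h. \<Sum>i\<in>I. F i h)"
  by (induction I rule: infinite_finite_induct) (auto intro: bounded_at_add bounded_at_const)

lemma sum_pmf_atMost: "(\<Sum>j\<le>m. pmf delay j) = tau delay m"
  by (simp add: tau_def measure_measure_pmf_finite)

lemma tau_bounds: "0 \<le> tau delay j" "tau delay j \<le> 1"
  by (simp_all add: tau_def)

lemma expectation_of_bool_le:
  "measure_pmf.expectation delay (\<lambda>d. of_bool (d \<le> j)) = tau delay j"
proof -
  have "(\<lambda>d. of_bool (d \<le> j)) = (indicator {..j} :: nat \<Rightarrow> real)"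
    by (auto simp: indicator_def)
  then show ?thesis by (simp add: tau_def)
qed

lemma sum_pmf_shift: "(\<Sum>t\<in>{s..s + m}. pmf delay (t - s)) = tau delay m"
proof -
  have "(\<Sum>t\<in>{s..s + m}. pmf delay (t - s)) = (\<Sum>j\<le>m. pmf delay j)"
    by (rule sum.reindex_bij_witness[where i = "\<lambda>j. j + s" and j = "\<lambda>t. t - s"]) auto
  then show ?thesis by (simp add: sum_pmf_atMost)
qed

lemma le_cSup_Collect:
  fixes p q :: real
  assumes "p \<le> q" "q \<le> 1" "P q"
  shows "q \<le> Sup {q. p \<le> q \<and> q \<le> 1 \<and> P q}"
  using assms by (intro cSup_upper) (auto intro!: bdd_aboveI[where M = 1])

section \<open>One-round conditional expectations and drift\<close>

text \<open>Only rates of arms that the policy plays are constrained, so the oracle that always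
  plays arm 1 is an instance too.\<close>

locale bandit =
  fixes \<theta> :: "nat \<Rightarrow> real" and delay :: "nat pmf" and pol :: "hist \<Rightarrow> nat"
  assumes rate: "0 \<le> \<theta> (pol h)" "\<theta> (pol h) \<le> 1"
begin

abbreviation E :: "nat \<Rightarrow> (hist \<Rightarrow> real) \<Rightarrow> real" where
  "E n F \<equiv> measure_pmf.expectation (run_pmf \<theta> delay pol n) F"

text \<open>The conditional expectation of \<open>F\<close> after one more round, given the history
  \<open>h\<close>.\<close>

definition step :: "(hist \<Rightarrow> real) \<Rightarrow> hist \<Rightarrow> real" where
  "step F h = \<theta> (pol h) * measure_pmf.expectation delay (\<lambda>d. F (h @ [(pol h, True, d)]))
     + (1 - \<theta> (pol h)) * measure_pmf.expectation delay (\<lambda>d. F (h @ [(pol h, False, d)]))"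

lemma E_Suc:
  assumes "bounded_at (Suc n) F"
  shows "E (Suc n) F = E n (step F)"
proof -
  obtain B where B: "\<bar>F h\<bar> \<le> B" if "length h = Suc n" for h
    using assms by (auto simp: bounded_at_def)
  have "E (Suc n) F = E n (\<lambda>h. measure_pmf.expectation (bind_pmf (bernoulli_pmf (\<theta> (pol h))) (\<lambda>c.
     bind_pmf delay (\<lambda>d. return_pmf (h @ [(pol h, c, d)])))) F)"
    unfolding run_pmf.simps
    by (rule integral_bind_pmf_bounded[where B = B]) (auto dest!: length_run_pmf intro!: B)
  also have "\<dots> = E n (step F)"
  proof (intro integral_cong_AE)
    show "AE h in run_pmf \<theta> delay pol n. measure_pmf.expectation
        (bind_pmf (bernoulli_pmf (\<theta> (pol h))) (\<lambda>c. bind_pmf delay (\<lambda>d. return_pmf (h @ [(pol h, c, d)])))) F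
        = step F h"
      unfolding AE_measure_pmf_iff
    proof
      fix h assume "h \<in> set_pmf (run_pmf \<theta> delay pol n)"
      then have len: "length h = n" by (rule length_run_pmf)
      have "measure_pmf.expectation (bind_pmf delay (\<lambda>d. return_pmf (h @ [(pol h, c, d)]))) F
          = measure_pmf.expectation delay (\<lambda>d. F (h @ [(pol h, c, d)]))" for c
        by (subst integral_bind_pmf_bounded[where B = B]) (auto intro!: B simp: len)
      then show "measure_pmf.expectation
        (bind_pmf (bernoulli_pmf (\<theta> (pol h))) (\<lambda>c. bind_pmf delay (\<lambda>d. return_pmf (h @ [(pol h, c, d)])))) F
        = step F h"
        by (subst integral_bind_pmf_bounded[where B = B])
           (auto intro!: B simp: len rate step_def mult.commute)
    qed
  qed auto
  finally show ?thesis .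
qed

lemma E_cong: "(\<And>h. length h = n \<Longrightarrow> F h = G h) \<Longrightarrow> E n F = E n G"
  by (intro integral_cong_AE) (auto simp: AE_measure_pmf_iff dest: length_run_pmf)

lemma E_integrable: "bounded_at n F \<Longrightarrow> integrable (run_pmf \<theta> delay pol n) F"
  unfolding bounded_at_def by (metis integrable_measure_pmf_bounded length_run_pmf)

lemma E_mono:
  assumes "\<And>h. length h = n \<Longrightarrow> F h \<le> G h" "bounded_at n F" "bounded_at n G"
  shows "E n F \<le> E n G"
  using assms by (intro integral_mono_AE E_integrable) (auto simp: AE_measure_pmf_iff dest: length_run_pmf)

lemma E_sum: "(\<And>i. i \<in> I \<Longrightarrow> bounded_at n (F i)) \<Longrightarrow> E n (\<lambda>h. \<Sum>i\<in>I. F i h) = (\<Sum>i\<in>I. E n (F i))"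
  by (intro Bochner_Integration.integral_sum E_integrable)

lemma bounded_at_step:
  assumes "bounded_at (Suc n) F"
  shows "bounded_at n (step F)"
proof -
  obtain B where B: "\<bar>F h\<bar> \<le> B" if "length h = Suc n" for h
    using assms by (auto simp: bounded_at_def)
  have e: "\<bar>measure_pmf.expectation delay (\<lambda>d. F (h @ [(pol h, c, d)]))\<bar> \<le> B" if "length h = n" for h c
  proof -
    have "\<bar>measure_pmf.expectation delay (\<lambda>d. F (h @ [(pol h, c, d)]))\<bar>
        \<le> measure_pmf.expectation delay (\<lambda>d. \<bar>F (h @ [(pol h, c, d)])\<bar>)"
      by (rule integral_abs_bound)
    also have "\<dots> \<le> measure_pmf.expectation delay (\<lambda>d. B)"
      using that B[of "h @ [(pol h, c, d)]" for d]
      by (intro integral_mono integrable_measure_pmf_bounded[where B = "\<bar>B\<bar>"]) (auto intro: order_trans[OF _ abs_ge_self])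
    finally show ?thesis by simp
  qed
  show ?thesis
  proof (rule bounded_atI)
    fix h :: hist assume h: "length h = n"
    have "\<bar>step F h\<bar> \<le> \<bar>\<theta> (pol h) * measure_pmf.expectation delay (\<lambda>d. F (h @ [(pol h, True, d)]))\<bar>
     + \<bar>(1 - \<theta> (pol h)) * measure_pmf.expectation delay (\<lambda>d. F (h @ [(pol h, False, d)]))\<bar>"
      unfolding step_def by (rule abs_triangle_ineq)
    also have "\<dots> \<le> \<theta> (pol h) * B + (1 - \<theta> (pol h)) * B"
      using rate[of h] e[OF h] by (intro add_mono) (auto simp: abs_mult intro!: mult_left_mono)
    finally show "\<bar>step F h\<bar> \<le> B" by (simp add: algebra_simps)
  qed
qed

text \<open>Telescoping of the expected one-round decrease. It is applied with a zero drift, with a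
  drift proportional to the potential, and with a drift that counts pulls.\<close>

lemma E_drift:
  assumes V: "\<And>n. bounded_at n V" and g: "\<And>n. bounded_at n g"
    and step: "\<And>h. length h < T \<Longrightarrow> step V h \<le> V h - g h"
  shows "E T V + (\<Sum>n<T. E n g) \<le> V []"
proof -
  have "E t V + (\<Sum>n<t. E n g) \<le> V []" if "t \<le> T" for t
    using that
  proof (induction t)
    case (Suc t)
    have "E (Suc t) V = E t (step V)" by (intro E_Suc V)
    also have "\<dots> \<le> E t (\<lambda>h. V h - g h)"
      using Suc.prems by (intro E_mono assms bounded_at_step bounded_at_diff) auto
    also have "\<dots> = E t V - E t g"
      by (intro Bochner_Integration.integral_diff E_integrable V g)
    finally show ?case using Suc by simp
  qed simp
  then show ?thesis by simp
qed

text \<open>The entry at list position \<open>i\<close> records round \<open>i + 1\<close>; \<open>cap i\<close> bounds the delays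
  counted for it.\<close>

definition conversions :: "(nat \<Rightarrow> nat) \<Rightarrow> nat \<Rightarrow> hist \<Rightarrow> real" where
  "conversions cap k h = (\<Sum>i<length h.
     of_bool (fst (h ! i) = k \<and> fst (snd (h ! i)) \<and> snd (snd (h ! i)) \<le> cap i))"

definition exposure :: "(nat \<Rightarrow> nat) \<Rightarrow> nat \<Rightarrow> hist \<Rightarrow> real" where
  "exposure cap k h = (\<Sum>i<length h. of_bool (fst (h ! i) = k) * tau delay (cap i))"

definition pulls :: "nat \<Rightarrow> hist \<Rightarrow> nat" where
  "pulls k h = (\<Sum>i<length h. of_bool (fst (h ! i) = k))"

lemma conversions_snoc: "conversions cap k (h @ [(a, c, d)]) =
    conversions cap k h + of_bool (a = k \<and> c \<and> d \<le> cap (length h))"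
  by (simp add: conversions_def nth_append)

lemma exposure_snoc: "exposure cap k (h @ [(a, c, d)]) =
    exposure cap k h + of_bool (a = k) * tau delay (cap (length h))"
  by (simp add: exposure_def nth_append)

lemma pulls_snoc: "pulls k (h @ [(a, c, d)]) = pulls k h + of_bool (a = k)"
  by (simp add: pulls_def nth_append)

lemma exposure_const: "exposure (\<lambda>_. m) k h = tau delay m * pulls k h"
  by (simp add: exposure_def pulls_def sum_distrib_left mult.commute)

lemma conversions_bounds: "0 \<le> conversions cap k h" "conversions cap k h \<le> length h"
proof -
  show "0 \<le> conversions cap k h" unfolding conversions_def by (intro sum_nonneg) auto
  have "conversions cap k h \<le> (\<Sum>i<length h. 1)"
    unfolding conversions_def by (intro sum_mono) auto
  then show "conversions cap k h \<le> length h" by simp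
qed

lemma exposure_nonneg: "0 \<le> exposure cap k h"
  unfolding exposure_def by (intro sum_nonneg) (auto simp: tau_bounds)

lemma pulls_le_length: "pulls k h \<le> length h"
proof -
  have "pulls k h \<le> (\<Sum>i<length h. 1)"
    unfolding pulls_def by (intro sum_mono) auto
  then show ?thesis by simp
qed

lemma exposure_le: "exposure cap k h \<le> length h"
proof -
  have "exposure cap k h \<le> (\<Sum>i<length h. 1)"
    unfolding exposure_def by (intro sum_mono) (auto simp: tau_bounds)
  then show ?thesis by simp
qed

section \<open>Exponential supermartingales and pull counts\<close>

text \<open>Centring by the Poisson log moment generating function makes the compensator depend on
  the caps through \<open>exposure\<close> alone; \<open>c\<close> is the discount rate per
  pull.\<close>

definition pot :: "real \<Rightarrow> real \<Rightarrow> (nat \<Rightarrow> nat) \<Rightarrow> nat \<Rightarrow> hist \<Rightarrow> real" where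
  "pot l c cap k h = exp (l * conversions cap k h
     - \<theta> k * (exp l - 1) * exposure cap k h - c * real (pulls k h))"

lemma bounded_at_pot: "bounded_at n (pot l c cap k)"
proof (rule bounded_atI)
  fix h :: hist assume h: "length h = n"
  have "l * conversions cap k h \<le> \<bar>l\<bar> * n"
    using conversions_bounds[of cap k h] h by (intro mult_mono) auto
  moreover have "- (\<theta> k * (exp l - 1) * exposure cap k h) \<le> \<bar>\<theta> k * (exp l - 1)\<bar> * n"
  proof -
    have "- (\<theta> k * (exp l - 1) * exposure cap k h) \<le> \<bar>\<theta> k * (exp l - 1)\<bar> * exposure cap k h"
      unfolding minus_mult_left by (intro mult_right_mono exposure_nonneg) linarith
    also have "\<dots> \<le> \<bar>\<theta> k * (exp l - 1)\<bar> * n"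
      using exposure_le[of cap k h] h by (intro mult_left_mono) auto
    finally show ?thesis .
  qed
  moreover have "- (c * real (pulls k h)) \<le> \<bar>c\<bar> * n"
  proof -
    have "- (c * real (pulls k h)) \<le> \<bar>c\<bar> * real (pulls k h)"
      unfolding minus_mult_left by (intro mult_right_mono) auto
    also have "\<dots> \<le> \<bar>c\<bar> * n"
      using pulls_le_length[of k h] h by (intro mult_left_mono) auto
    finally show ?thesis .
  qed
  ultimately show "\<bar>pot l c cap k h\<bar> \<le> exp (\<bar>l\<bar> * n + \<bar>\<theta> k * (exp l - 1)\<bar> * n + \<bar>c\<bar> * n)"
    by (simp add: pot_def)
qed

text \<open>A pull of \<open>k\<close> yields a counted conversion with probability
  \<open>\<theta> k\<close> times the delay CDF at the cap, and the compensator dominates the mean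
  growth. The cap must be a function of the position only, not of the history.\<close>

lemma step_pot:
  "step (pot l c cap k) h \<le> (if pol h = k then exp (- c) else 1) * pot l c cap k h"
proof (cases "pol h = k")
  case False
  then have "pot l c cap k (h @ [(pol h, b, d)]) = pot l c cap k h" for b d
    by (simp add: pot_def conversions_snoc exposure_snoc pulls_snoc)
  with False show ?thesis by (simp add: step_def algebra_simps)
next
  case True
  define \<tau> where "\<tau> = tau delay (cap (length h))"
  \<comment> \<open>\<open>W\<close> is the value after a pull without a counted conversion; a
    counted one multiplies it by \<open>exp l\<close>.\<close>
  define W where "W = pot l c cap k h * exp (- \<theta> k * (exp l - 1) * \<tau> - c)"
  have F: "pot l c cap k (h @ [(pol h, False, d)]) = W" for d
    using True by (simp add: pot_def conversions_snoc exposure_snoc pulls_snoc W_def \<tau>_def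
      exp_add[symmetric] algebra_simps)
  have T: "pot l c cap k (h @ [(pol h, True, d)]) = W * (1 + (exp l - 1) * of_bool (d \<le> cap (length h)))" for d
    using True by (cases "d \<le> cap (length h)") (simp_all add: pot_def conversions_snoc exposure_snoc pulls_snoc W_def \<tau>_def
      exp_add[symmetric] algebra_simps)
  have "measure_pmf.expectation delay (\<lambda>d. 1 + (exp l - 1) * of_bool (d \<le> cap (length h))) = 1 + (exp l - 1) * \<tau>"
  proof -
    have "integrable (measure_pmf delay) (\<lambda>d. of_bool (d \<le> cap (length h)) :: real)"
      by (intro integrable_measure_pmf_bounded[where B = 1]) auto
    then show ?thesis by (simp add: expectation_of_bool_le \<tau>_def)
  qed
  then have "step (pot l c cap k) h = \<theta> k * (W * (1 + (exp l - 1) * \<tau>)) + (1 - \<theta> k) * W"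
    unfolding step_def F T using True by simp
  also have "\<dots> = W * (1 + \<theta> k * (exp l - 1) * \<tau>)" by (simp add: algebra_simps)
  also have "\<dots> \<le> W * exp (\<theta> k * (exp l - 1) * \<tau>)"
    by (intro mult_left_mono exp_ge_add_one_self) (auto simp: W_def pot_def)
  also have "\<dots> = pot l c cap k h * exp ((- \<theta> k * (exp l - 1) * \<tau> - c) + \<theta> k * (exp l - 1) * \<tau>)"
    unfolding W_def exp_add by (rule mult.assoc)
  also have "\<dots> = exp (- c) * pot l c cap k h" by simp
  finally show ?thesis using True by simp
qed

lemma E_pot_le_1: "E n (pot l 0 cap k) \<le> 1"
proof -
  have "E n (pot l 0 cap k) + (\<Sum>n<n. E n (\<lambda>_. 0)) \<le> pot l 0 cap k []"
  proof (intro E_drift bounded_at_pot bounded_at_const)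
    show "step (pot l 0 cap k) h \<le> pot l 0 cap k h - 0" for h
      using step_pot[of l 0 cap k h] by (simp split: if_splits)
  qed
  then show ?thesis by (simp add: pot_def conversions_def exposure_def pulls_def)
qed

text \<open>Each pull destroys at least the fraction \<open>1 - exp (- c)\<close> of the current
  potential in expectation, and the total loss cannot exceed the initial value 1. The bound is
  therefore free of \<open>T\<close>.\<close>

lemma sum_E_pot_le:
  assumes "0 < c"
  shows "(\<Sum>n<T. E n (\<lambda>h. of_bool (pol h = k) * pot l c cap k h)) \<le> 1 / (1 - exp (- c))"
proof -
  have c: "exp (- c) < 1" using assms by simp
  define g where "g = (\<lambda>h. of_bool (pol h = k) * pot l c cap k h)"
  have "E T (pot l c cap k) + (\<Sum>n<T. E n (\<lambda>h. (1 - exp (- c)) * g h)) \<le> pot l c cap k []"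
  proof (intro E_drift bounded_at_pot bounded_at_cmult)
    show "bounded_at n g" for n
      unfolding g_def by (intro bounded_at_mult bounded_at_of_bool bounded_at_pot)
    show "step (pot l c cap k) h \<le> pot l c cap k h - (1 - exp (- c)) * g h" for h
      using step_pot[of l c cap k h] by (auto simp: g_def algebra_simps split: if_splits)
  qed
  moreover have "pot l c cap k [] = 1" by (simp add: pot_def conversions_def exposure_def pulls_def)
  moreover have "0 \<le> E T (pot l c cap k)" by (intro Bochner_Integration.integral_nonneg) (simp add: pot_def)
  ultimately have "(1 - exp (- c)) * (\<Sum>n<T. E n g) \<le> 1"
    by (simp add: sum_distrib_left)
  then show ?thesis using c by (simp add: g_def field_simps)
qed

text \<open>The potential is the negated pull count clipped at \<open>N + 1\<close>: it drops by one
  exactly in the rounds counted here and never goes below \<open>- (N + 1)\<close>.\<close>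

lemma sum_E_pulls_le:
  "(\<Sum>n<T. E n (\<lambda>h. of_bool (pol h = k \<and> pulls k h \<le> N))) \<le> real N + 1"
proof -
  define V where "V = (\<lambda>h. - real (min (pulls k h) (Suc N)))"
  have bV: "bounded_at n V" for n
    by (rule bounded_atI[where B = "real (Suc N)"]) (simp add: V_def)
  have "E T V + (\<Sum>n<T. E n (\<lambda>h. of_bool (pol h = k \<and> pulls k h \<le> N))) \<le> V []"
  proof (intro E_drift bV bounded_at_of_bool)
    fix h
    have "V (h @ [(pol h, c, d)]) = V h - of_bool (pol h = k \<and> pulls k h \<le> N)" for c d
      unfolding V_def pulls_snoc by (auto simp: min_def)
    then show "step V h \<le> V h - of_bool (pol h = k \<and> pulls k h \<le> N)"
      by (simp only: step_def) (simp add: algebra_simps)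
  qed
  moreover have "V [] = 0" by (simp add: V_def pulls_def)
  moreover have "E T (\<lambda>h. - real N - 1) \<le> E T V"
    by (intro E_mono bV bounded_at_const) (simp add: V_def min_def)
  ultimately show ?thesis by simp
qed

section \<open>Reduction of the regret to gaps of the arms played\<close>

lemma E_add: "bounded_at n F \<Longrightarrow> bounded_at n G \<Longrightarrow> E n (\<lambda>h. F h + G h) = E n F + E n G"
  by (intro Bochner_Integration.integral_add E_integrable)

lemma bounded_at_rate: "bounded_at n (\<lambda>h. \<theta> (pol h))"
  by (rule bounded_atI[where B = 1]) (simp add: rate)

text \<open>The arm of round \<open>s\<close> is fixed by the first \<open>s - 1\<close> entries,
  then conversion and delay are drawn independently; later rounds leave that entry unchanged, which
  is the induction step.\<close>

lemma E_conversion: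
  assumes "1 \<le> s" "s \<le> T"
  shows "E T (\<lambda>h. of_bool (conv_of h s \<and> delay_of h s = j)) = E (s - 1) (\<lambda>h. \<theta> (pol h)) * pmf delay j"
  using assms(2)
proof (induction T rule: dec_induct)
  case base
  obtain n where s: "s = Suc n" using assms(1) by (cases s) auto
  have ind: "measure_pmf.expectation delay (\<lambda>d. of_bool (d = j)) = pmf delay j"
  proof -
    have "(\<lambda>d. of_bool (d = j)) = (indicator {j} :: nat \<Rightarrow> real)" by (auto simp: indicator_def)
    then show ?thesis by (simp add: measure_pmf_single)
  qed
  have "E (Suc n) (\<lambda>h. of_bool (conv_of h s \<and> delay_of h s = j))
      = E n (step (\<lambda>h. of_bool (conv_of h s \<and> delay_of h s = j)))"
    by (intro E_Suc bounded_at_of_bool)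
  also have "\<dots> = E n (\<lambda>h. \<theta> (pol h) * pmf delay j)"
    by (intro E_cong) (simp add: step_def conv_of_def delay_of_def s nth_append ind)
  finally show ?case by (simp add: s)
next
  case (step T)
  then have "s - 1 < T" using assms(1) by linarith
  have "E (Suc T) (\<lambda>h. of_bool (conv_of h s \<and> delay_of h s = j))
      = E T (bandit.step \<theta> delay pol (\<lambda>h. of_bool (conv_of h s \<and> delay_of h s = j)))"
    by (intro E_Suc bounded_at_of_bool)
  also have "\<dots> = E T (\<lambda>h. of_bool (conv_of h s \<and> delay_of h s = j))"
    using \<open>s - 1 < T\<close>
    by (intro E_cong) (simp add: step_def conv_of_def delay_of_def nth_append algebra_simps)
  finally show ?case using step by simp
qed

text \<open>Truncated subtraction lets \<open>s = 0\<close> into the inner sum when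
  \<open>t \<le> m\<close>; the guard discards it.\<close>

lemma expected_reward_eq:
  "expected_reward \<theta> delay m pol T = (\<Sum>t\<in>{1..T}. \<Sum>s\<in>{t - m..t}.
     if 1 \<le> s then pmf delay (t - s) * E (s - 1) (\<lambda>h. \<theta> (pol h)) else 0)"
proof -
  have "expected_reward \<theta> delay m pol T = E T (\<lambda>h. \<Sum>t\<in>{1..T}. \<Sum>s\<in>{t - m..t}.
     of_bool (1 \<le> s \<and> conv_of h s \<and> delay_of h s = t - s))"
    unfolding expected_reward_def cum_reward_def Y_def of_bool_def ..
  also have "\<dots> = (\<Sum>t\<in>{1..T}. \<Sum>s\<in>{t - m..t}.
     E T (\<lambda>h. of_bool (1 \<le> s \<and> conv_of h s \<and> delay_of h s = t - s)))"
    by (simp only: E_sum bounded_at_sum bounded_at_of_bool)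
  also have "\<dots> = (\<Sum>t\<in>{1..T}. \<Sum>s\<in>{t - m..t}.
     if 1 \<le> s then pmf delay (t - s) * E (s - 1) (\<lambda>h. \<theta> (pol h)) else 0)"
    by (intro sum.cong refl) (use E_conversion in auto)
  finally show ?thesis .
qed

text \<open>After exchanging the sums, round \<open>s\<close> contributes its expected gap weighted
  by the probability that the delay is at most \<open>m\<close> and the reward arrives by time
  \<open>T\<close>. Only \<open>tau delay m\<close> remains once the horizon is ignored.\<close>

lemma regret_le:
  assumes "0 \<le> \<theta> 1" "\<theta> 1 \<le> 1" and best: "\<And>h. \<theta> (pol h) \<le> \<theta> 1"
  shows "regret \<theta> delay m pol T \<le> tau delay m * (\<Sum>n<T. E n (\<lambda>h. \<theta> 1 - \<theta> (pol h)))"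
proof -
  interpret opt: bandit \<theta> delay "\<lambda>_. 1" using assms by unfold_locales auto
  define r where "r = (\<lambda>s. E (s - 1) (\<lambda>h. \<theta> 1 - \<theta> (pol h)))"
  have r: "r s = \<theta> 1 - E (s - 1) (\<lambda>h. \<theta> (pol h))" for s
    unfolding r_def by (subst Bochner_Integration.integral_diff)
      (auto intro!: E_integrable bounded_at_rate)
  have r0: "0 \<le> r s" for s
    unfolding r_def by (intro Bochner_Integration.integral_nonneg) (use best in simp)
  have "regret \<theta> delay m pol T = (\<Sum>t\<in>{1..T}. \<Sum>s\<in>{t - m..t}. if 1 \<le> s then pmf delay (t - s) * r s else 0)"
    unfolding regret_def expected_reward_eq opt.expected_reward_eq sum_subtractf[symmetric]
    by (intro sum.cong refl) (simp add: r right_diff_distrib)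
  also have "\<dots> = (\<Sum>t\<in>{1..T}. \<Sum>s\<in>{1..T}. if s \<le> t \<and> t \<le> s + m then pmf delay (t - s) * r s else 0)"
    by (intro sum.cong refl sum.mono_neutral_cong) auto
  also have "\<dots> = (\<Sum>s\<in>{1..T}. \<Sum>t\<in>{1..T}. if s \<le> t \<and> t \<le> s + m then pmf delay (t - s) * r s else 0)"
    by (rule sum.swap)
  also have "\<dots> \<le> (\<Sum>s\<in>{1..T}. tau delay m * r s)"
  proof (intro sum_mono)
    fix s
    have "(\<Sum>t\<in>{1..T}. if s \<le> t \<and> t \<le> s + m then pmf delay (t - s) * r s else 0)
        = (\<Sum>t\<in>{1..T} \<inter> {s..s + m}. pmf delay (t - s) * r s)"
      by (intro sum.mono_neutral_cong_right) auto
    \<comment> \<open>Extending the range beyond \<open>T\<close> is allowed because the expected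
      gap \<open>r s\<close> is non-negative.\<close>
    also have "\<dots> \<le> (\<Sum>t\<in>{s..s + m}. pmf delay (t - s) * r s)"
      by (intro sum_mono2) (auto simp: r0)
    also have "\<dots> = tau delay m * r s"
      by (simp add: sum_pmf_shift sum_distrib_right[symmetric])
    finally show "(\<Sum>t\<in>{1..T}. if s \<le> t \<and> t \<le> s + m then pmf delay (t - s) * r s else 0)
        \<le> tau delay m * r s" .
  qed
  also have "\<dots> = tau delay m * (\<Sum>n<T. r (Suc n))"
    by (simp add: sum_distrib_left sum.atLeast1_atMost_eq)
  finally show ?thesis by (simp add: r_def)
qed

section \<open>The estimators as counts with delay caps\<close>

text \<open>With \<open>n = length h\<close> the current time is \<open>n + 1\<close> and position
  \<open>i\<close> is round \<open>i + 1\<close>, so the age \<open>t - s\<close> is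
  \<open>n - i\<close>.\<close>

lemma Sk_eq: "Sk m h k = conversions (\<lambda>i. min (length h - i) m) k h"
  by (simp add: Sk_def conversions_def arm_of_def conv_of_def delay_of_def Let_def
      sum.atLeast1_atMost_eq of_bool_def del: min_less_iff_conj)

text \<open>Both sums in \<open>Ntilde\<close> weight a round by the delay CDF at its age capped at
  \<open>m\<close>; \<open>1 \<le> m\<close> makes the two ranges a partition of the past
  rounds.\<close>

lemma Ntilde_eq:
  assumes "1 \<le> m"
  shows "Ntilde delay m h k = exposure (\<lambda>i. min (length h - i) m) k h"
proof -
  define n where "n = length h"
  define w where "w = (\<lambda>s. if arm_of h s = k then tau delay (min (Suc n - s) m) else 0)"
  have "Ntilde delay m h k = (\<Sum>s\<in>{1..Suc n - m}. w s) + (\<Sum>s\<in>{Suc n - m + 1..n}. w s)"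
    unfolding Ntilde_def Let_def sum_distrib_left
    by (intro arg_cong2[where f = "(+)"] sum.cong) (auto simp: w_def n_def min_def intro!: arg_cong[where f = "tau delay"])
  also have "\<dots> = (\<Sum>s\<in>{1..n}. w s)"
    using assms by (subst sum.union_disjoint[symmetric]) (auto intro!: sum.cong)
  also have "\<dots> = exposure (\<lambda>i. min (length h - i) m) k h"
    unfolding One_nat_def sum.atLeast1_atMost_eq exposure_def n_def[symmetric]
    by (intro sum.cong) (auto simp: w_def arm_of_def)
  finally show ?thesis .
qed

text \<open>At most \<open>m\<close> rounds have age below \<open>m\<close>, and each of them loses
  at most \<open>tau delay m\<close> against full weight.\<close>

lemma Ntilde_ge:
  assumes "1 \<le> m"
  shows "tau delay m * (real (pulls k h) - real m) \<le> Ntilde delay m h k"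
proof -
  define n where "n = length h"
  have "card {i \<in> {..<n}. n - i < m} \<le> card {..<m}"
    by (rule card_inj_on_le[where f = "\<lambda>i. n - i"]) (auto simp: inj_on_def)
  moreover have "{i \<in> {..<n}. n - i < m} = {..<n} \<inter> {i. n - i < m}" by auto
  ultimately have card: "(\<Sum>i<n. of_bool (n - i < m)) \<le> real m"
    by simp
  have "tau delay m * real (pulls k h) = (\<Sum>i<n. of_bool (fst (h ! i) = k) * tau delay m)"
    by (simp add: pulls_def n_def sum_distrib_left mult.commute)
  also have "\<dots> \<le> (\<Sum>i<n. of_bool (fst (h ! i) = k) * tau delay (min (n - i) m)
      + tau delay m * of_bool (n - i < m))"
    by (intro sum_mono) (auto simp: min_def tau_bounds)
  also have "\<dots> = Ntilde delay m h k + tau delay m * (\<Sum>i<n. of_bool (n - i < m))"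
    by (simp only: Ntilde_eq[OF assms] exposure_def n_def sum.distrib sum_distrib_left)
  also have "\<dots> \<le> Ntilde delay m h k + tau delay m * m"
    by (intro add_left_mono mult_left_mono card tau_bounds)
  finally show ?thesis by (simp add: algebra_simps)
qed

lemma Ntilde_nonneg: "1 \<le> m \<Longrightarrow> 0 \<le> Ntilde delay m h k"
  by (simp add: Ntilde_eq exposure_nonneg)

lemma theta_hat_nonneg: "1 \<le> m \<Longrightarrow> 0 \<le> theta_hat delay m h k"
  unfolding theta_hat_def by (intro divide_nonneg_nonneg Ntilde_nonneg) (simp add: Sk_eq conversions_bounds)

text \<open>Passing to the constant cap \<open>m\<close> removes the dependence on the current time,
  so that one supermartingale serves all rounds.\<close>

lemma conversions_le_full: "conversions (\<lambda>i. min (u i) m) k h \<le> conversions (\<lambda>_. m) k h"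
  unfolding conversions_def by (intro sum_mono) auto

end

section \<open>The upper confidence bound\<close>

lemma ucb_index_ge_theta_hat:
  assumes "0 \<le> \<epsilon>"
  shows "theta_hat delay m h k \<le> ucb_index \<epsilon> delay m h k"
proof (cases "theta_hat delay m h k \<le> 1")
  case True
  have "Ntilde delay m h k * d_pois (theta_hat delay m h k) (theta_hat delay m h k)
      \<le> (1 + \<epsilon>) * ln (real (length h + 1))"
    using assms by (cases "theta_hat delay m h k = 0") (auto simp: d_pois_def)
  then show ?thesis
    using True by (simp add: ucb_index_def Let_def le_cSup_Collect)
qed (simp add: ucb_index_def Let_def)

text \<open>If the divergence were within budget at \<open>\<mu>\<close>, then \<open>\<mu>\<close>
  would belong to the set whose supremum is the index.\<close>

lemma ucb_index_lessD:
  assumes "0 \<le> \<epsilon>" "\<mu> \<le> 1" "ucb_index \<epsilon> delay m h k < \<mu>"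
  shows "theta_hat delay m h k < \<mu>"
    "(1 + \<epsilon>) * ln (real (length h + 1)) < Ntilde delay m h k * d_pois (theta_hat delay m h k) \<mu>"
proof -
  show hat: "theta_hat delay m h k < \<mu>"
    using ucb_index_ge_theta_hat[of \<epsilon> delay m h k] assms by linarith
  show "(1 + \<epsilon>) * ln (real (length h + 1)) < Ntilde delay m h k * d_pois (theta_hat delay m h k) \<mu>"
  proof (rule ccontr)
    assume "\<not> ?thesis"
    then have "\<mu> \<le> ucb_index \<epsilon> delay m h k"
      using hat assms by (simp add: ucb_index_def Let_def le_cSup_Collect)
    then show False using assms by simp
  qed
qed

text \<open>An index strictly above \<open>\<mu>\<close> yields a member \<open>q > \<mu>\<close> of
  the confidence set without asking whether the supremum is attained. Monotonicity in both arguments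
  then replaces the random pair by the fixed \<open>p'\<close> and \<open>\<mu>\<close>.\<close>

lemma ucb_index_greaterD:
  assumes "0 \<le> \<epsilon>" "0 < p'" "p' < \<mu>" "\<mu> \<le> 1" "\<mu> < ucb_index \<epsilon> delay m h k"
    "0 \<le> theta_hat delay m h k" "theta_hat delay m h k \<le> p'" "0 \<le> Ntilde delay m h k"
  shows "Ntilde delay m h k * d_pois p' \<mu> \<le> (1 + \<epsilon>) * ln (real (length h + 1))"
proof -
  define p where "p = theta_hat delay m h k"
  define Q where "Q = {q. p \<le> q \<and> q \<le> 1 \<and> Ntilde delay m h k * d_pois p q
    \<le> (1 + \<epsilon>) * ln (real (length h + 1))}"
  have "p \<le> 1" using assms by (simp add: p_def)
  then have "\<mu> < Sup Q" using assms by (simp add: ucb_index_def Let_def Q_def p_def)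
  moreover have "p \<in> Q"
    using \<open>p \<le> 1\<close> assms by (cases "p = 0") (auto simp: Q_def d_pois_def)
  ultimately obtain q where q: "q \<in> Q" "\<mu> < q" using less_cSupD[of Q] by auto
  have "d_pois p' \<mu> \<le> d_pois p \<mu>"
    using assms by (intro d_pois_antimono_left) (auto simp: p_def)
  also have "\<dots> \<le> d_pois p q"
    using assms q by (intro d_pois_mono_right) (auto simp: p_def)
  finally have "Ntilde delay m h k * d_pois p' \<mu> \<le> Ntilde delay m h k * d_pois p q"
    using assms by (intro mult_left_mono)
  then show ?thesis using q by (simp add: Q_def)
qed

section \<open>Expected pulls of a suboptimal arm\<close>

context bandit
begin

lemma E_ucb_index_less:
  assumes m: "1 \<le> m" and "0 \<le> \<epsilon>" "0 < \<mu>" "\<mu> < \<theta> k" "\<theta> k \<le> 1"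
  shows "\<exists>C. \<forall>n. E n (\<lambda>h. of_bool (ucb_index \<epsilon> delay m h k < \<mu>)) \<le> C * real (Suc n) powr - (1 + \<epsilon>)"
proof -
  obtain L where L: "finite L"
    "\<And>x. 0 \<le> x \<Longrightarrow> x \<le> \<mu> \<Longrightarrow> \<exists>l\<in>L. d_pois x \<mu> \<le> l * x - \<theta> k * (exp l - 1)"
    using d_pois_finite_fenchel_cover[of \<mu> "\<theta> k"] assms by metis
  have "E n (\<lambda>h. of_bool (ucb_index \<epsilon> delay m h k < \<mu>)) \<le> card L * real (Suc n) powr - (1 + \<epsilon>)" for n
  proof -
    \<comment> \<open>The caps seen after \<open>n\<close> rounds are deterministic once
      \<open>n\<close> is fixed, so \<open>pot\<close> with these caps is a supermartingale along
      the whole run up to \<open>n\<close>.\<close>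
    define cap where "cap = (\<lambda>i. min (n - i) m)"
    define w where "w = real (Suc n) powr - (1 + \<epsilon>)"
    have bnd: "bounded_at n (\<lambda>h. w * pot l 0 cap k h)" for l
      by (intro bounded_at_cmult bounded_at_pot)
    have "E n (\<lambda>h. of_bool (ucb_index \<epsilon> delay m h k < \<mu>)) \<le> E n (\<lambda>h. \<Sum>l\<in>L. w * pot l 0 cap k h)"
    proof (intro E_mono bounded_at_of_bool bounded_at_sum bnd)
      fix h :: hist assume n: "length h = n"
      have nonneg: "0 \<le> (\<Sum>l\<in>L. w * pot l 0 cap k h)"
        by (intro sum_nonneg) (simp add: w_def pot_def)
      show "of_bool (ucb_index \<epsilon> delay m h k < \<mu>) \<le> (\<Sum>l\<in>L. w * pot l 0 cap k h)"
      proof (cases "ucb_index \<epsilon> delay m h k < \<mu>")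
        case True
        define x where "x = theta_hat delay m h k"
        define N where "N = Ntilde delay m h k"
        define \<beta> where "\<beta> = (1 + \<epsilon>) * ln (real (Suc n))"
        have x: "0 \<le> x" "x < \<mu>" and \<beta>: "\<beta> < N * d_pois x \<mu>"
          using ucb_index_lessD[OF _ _ True] theta_hat_nonneg[OF m, of h k] assms n
          by (auto simp: x_def N_def \<beta>_def)
        obtain l where l: "l \<in> L" "d_pois x \<mu> \<le> l * x - \<theta> k * (exp l - 1)"
          using L(2)[of x] x by auto
        \<comment> \<open>As \<open>N * d_pois x \<mu>\<close> strictly exceeds a non-negative
          number, \<open>N\<close> is nonzero, and the estimate is a true quotient rather than the
          default of division by zero.\<close>
        have "0 \<le> \<beta>" using assms by (simp add: \<beta>_def)
        with \<beta> have "N \<noteq> 0" by auto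
        then have S: "N * x = conversions cap k h" and N: "N = exposure cap k h"
          using n by (simp_all add: x_def N_def theta_hat_def Sk_eq cap_def Ntilde_eq[OF m])
        have "\<beta> \<le> N * (l * x - \<theta> k * (exp l - 1))"
          using \<beta> l Ntilde_nonneg[OF m, of h k] N_def by (meson less_imp_le mult_left_mono order_trans)
        also have "\<dots> = l * (N * x) - \<theta> k * (exp l - 1) * N" by (simp add: algebra_simps)
        finally have "exp \<beta> \<le> pot l 0 cap k h" by (simp add: pot_def S N[symmetric])
        then have "w * exp \<beta> \<le> w * pot l 0 cap k h"
          by (intro mult_left_mono) (simp_all add: w_def)
        moreover have "w = exp (- \<beta>)" by (simp add: w_def \<beta>_def powr_def algebra_simps)
        ultimately have "1 \<le> w * pot l 0 cap k h" by (simp add: exp_minus)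
        also have "\<dots> \<le> (\<Sum>l\<in>L. w * pot l 0 cap k h)"
          using l L by (intro member_le_sum) (auto simp: w_def pot_def)
        finally show ?thesis using True by simp
      qed (use nonneg in simp)
    qed
    also have "\<dots> = (\<Sum>l\<in>L. w * E n (pot l 0 cap k))"
      by (subst E_sum) (auto intro!: bnd)
    also have "\<dots> \<le> (\<Sum>l\<in>L. w * 1)"
      by (intro sum_mono mult_left_mono E_pot_le_1) (simp add: w_def)
    finally show ?thesis by (simp add: w_def)
  qed
  then show ?thesis by blast
qed

lemma expected_pulls_le:
  assumes m: "1 \<le> m" and eps: "0 < \<epsilon>" and alg: "is_DelayedKLUCB K \<epsilon> delay m pol"
    and tau: "0 < tau delay m" and "1 \<le> K"
    and order: "0 \<le> \<theta> k" "\<theta> k < p" "p < \<mu>" "\<mu> < \<theta> 1" "\<theta> 1 \<le> 1"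
  shows "\<exists>C. \<forall>T. (\<Sum>n<T. E n (\<lambda>h. of_bool (pol h = k)))
    \<le> (1 + \<epsilon>) * ln (real T) / (tau delay m * d_pois p \<mu>) + C"
proof -
  define \<tau> where "\<tau> = tau delay m"
  define d where "d = d_pois p \<mu>"
  have d: "0 < d" unfolding d_def using order by (intro d_pois_pos) auto
  have \<tau>: "0 < \<tau>" using tau by (simp add: \<tau>_def)
  \<comment> \<open>Arm 1 is compared with a level strictly between \<open>\<mu>\<close> and
    \<open>\<theta> 1\<close>, so that the index of the arm played is strictly above
    \<open>\<mu>\<close>.\<close>
  define \<mu>' where "\<mu>' = (\<mu> + \<theta> 1) / 2"
  have \<mu>': "\<mu> < \<mu>'" "\<mu>' < \<theta> 1" using order by (auto simp: \<mu>'_def)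
  obtain C1 where C1: "\<And>n. E n (\<lambda>h. of_bool (ucb_index \<epsilon> delay m h 1 < \<mu>'))
      \<le> C1 * real (Suc n) powr - (1 + \<epsilon>)"
    using E_ucb_index_less[OF m, of \<epsilon> \<mu>' 1] eps order \<mu>' by auto
  have C1_nonneg: "0 \<le> C1"
  proof -
    have "0 \<le> E 0 (\<lambda>h. of_bool (ucb_index \<epsilon> delay m h 1 < \<mu>'))"
      by (intro Bochner_Integration.integral_nonneg) simp
    also have "\<dots> \<le> C1" using C1[of 0] by simp
    finally show ?thesis .
  qed
  \<comment> \<open>This tilt is small enough that \<open>\<theta> k * (exp l - 1)\<close> stays
    below \<open>l * p\<close>, so \<open>c\<close> is positive. \<open>c\<close> is the excess of
    the exponent per fully weighted pull when the estimate is above \<open>p\<close>, and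
    \<open>D\<close> absorbs the up to \<open>m\<close> recent pulls of smaller weight.\<close>
  define l where "l = (p - \<theta> k) / 2"
  define c where "c = \<tau> * (l * p - \<theta> k * (exp l - 1))"
  define D where "D = exp (l * p * \<tau> * m)"
  have l: "0 < l" "l \<le> 1" using order by (auto simp: l_def)
  have c: "0 < c"
  proof -
    have "\<theta> k * (exp l - 1) \<le> \<theta> k * (l + l\<^sup>2)"
      using exp_bound[of l] l order by (intro mult_left_mono) auto
    also have "\<dots> \<le> \<theta> k * l + 1 * l\<^sup>2"
      unfolding distrib_left using order by (intro add_left_mono mult_right_mono) auto
    also have "\<dots> = l * (\<theta> k + l)" by (simp add: power2_eq_square algebra_simps)
    also have "\<dots> < l * p"
      using order l by (intro mult_strict_left_mono) (auto simp: l_def field_simps)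
    finally show ?thesis using \<tau> by (simp add: c_def)
  qed
  define B where "B = C1 * (\<Sum>n. real (Suc n) powr - (1 + \<epsilon>))"
  have summ: "summable (\<lambda>n. real (Suc n) powr - (1 + \<epsilon>))"
    using eps by (subst summable_Suc_iff) (simp add: summable_real_powr_iff)
  have "(\<Sum>n<T. E n (\<lambda>h. of_bool (pol h = k)))
    \<le> (1 + \<epsilon>) * ln (real T) / (\<tau> * d) + (K + B + m + 1 + D * (1 / (1 - exp (- c))))" for T
  proof -
    \<comment> \<open>The solution of \<open>\<tau> * (x - m) * d = (1 + \<epsilon>) * ln T\<close>,
      where \<open>m\<close> comes from \<open>Ntilde_ge\<close>. For \<open>T = 0\<close> it equals
      \<open>m\<close>, since \<open>ln 0 = 0\<close>.\<close>
    define x where "x = (1 + \<epsilon>) * ln (real T) / (\<tau> * d) + m"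
    have x0: "0 \<le> x"
      using eps \<tau> d by (cases "T = 0") (auto simp: x_def intro!: add_nonneg_nonneg divide_nonneg_nonneg)
    \<comment> \<open>A pull of \<open>k\<close> falls into the initial rounds, or arm 1 has a low
      index, or \<open>k\<close> has few pulls so far, or its estimate exceeds \<open>p\<close>. The
      last event is bounded by the discounted potential in \<open>F4\<close>.\<close>
    define F1 :: "hist \<Rightarrow> real" where "F1 = (\<lambda>h. of_bool (length h < K))"
    define F2 :: "hist \<Rightarrow> real" where "F2 = (\<lambda>h. of_bool (ucb_index \<epsilon> delay m h 1 < \<mu>'))"
    define F3 :: "hist \<Rightarrow> real" where "F3 = (\<lambda>h. of_bool (pol h = k \<and> pulls k h \<le> nat \<lfloor>x\<rfloor>))"
    define F4 where "F4 = (\<lambda>h. of_bool (pol h = k) * pot l c (\<lambda>_. m) k h)"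
    have bnd: "bounded_at n F1" "bounded_at n F2" "bounded_at n F3" "bounded_at n F4" for n
      unfolding F1_def F2_def F3_def F4_def
      by (intro bounded_at_of_bool bounded_at_mult bounded_at_pot)+
    have pointwise: "of_bool (pol h = k) \<le> F1 h + F2 h + F3 h + D * F4 h" if h: "length h < T" for h
    proof -
      have nonneg: "0 \<le> F1 h" "0 \<le> F2 h" "0 \<le> F3 h" "0 \<le> D * F4 h"
        by (simp_all add: F1_def F2_def F3_def F4_def D_def pot_def)
      have "1 \<le> D * F4 h" if k: "pol h = k" and "K \<le> length h"
        and u: "\<mu>' \<le> ucb_index \<epsilon> delay m h 1" and pulls: "\<not> pulls k h \<le> nat \<lfloor>x\<rfloor>"
      proof -
        define N where "N = Ntilde delay m h k"
        have N: "\<tau> * (real (pulls k h) - m) \<le> N" "0 \<le> N"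
          using Ntilde_ge[OF m] Ntilde_nonneg[OF m] by (simp_all add: N_def \<tau>_def)
        have "ucb_index \<epsilon> delay m h 1 \<le> ucb_index \<epsilon> delay m h k"
          using alg \<open>K \<le> length h\<close> \<open>1 \<le> K\<close> k by (auto simp: is_DelayedKLUCB_def)
        then have u_k: "\<mu> < ucb_index \<epsilon> delay m h k" using u \<mu>' by linarith
        have "p < theta_hat delay m h k"
        proof (rule ccontr)
          assume "\<not> ?thesis"
          then have "N * d \<le> (1 + \<epsilon>) * ln (real (length h + 1))"
            unfolding N_def d_def using eps order u_k m
            by (intro ucb_index_greaterD theta_hat_nonneg Ntilde_nonneg) auto
          also have "\<dots> \<le> (1 + \<epsilon>) * ln (real T)"
            using h eps by (intro mult_left_mono) auto
          finally have "\<tau> * (real (pulls k h) - m) * d \<le> (1 + \<epsilon>) * ln (real T)"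
            using N d by (meson less_imp_le mult_right_mono order_trans)
          then have "real (pulls k h) \<le> x"
            using \<tau> d by (simp add: x_def field_simps)
          then show False using pulls by (simp add: le_nat_floor)
        qed
        then have hat: "p < Sk m h k / N" by (simp add: theta_hat_def N_def)
        have "N \<noteq> 0" using hat order by auto
        then have "p * N < Sk m h k" using hat N(2) by (simp add: field_simps)
        moreover have "p * (\<tau> * (real (pulls k h) - m)) \<le> p * N"
          using N(1) order by (intro mult_left_mono) auto
        moreover have "Sk m h k \<le> conversions (\<lambda>_. m) k h"
          unfolding Sk_eq by (rule conversions_le_full)
        ultimately have "p * (\<tau> * (real (pulls k h) - m)) < conversions (\<lambda>_. m) k h"
          by linarith
        then have "l * (p * (\<tau> * (real (pulls k h) - m))) \<le> l * conversions (\<lambda>_. m) k h"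
          using l by (intro mult_left_mono) auto
        then have "0 \<le> l * p * \<tau> * m + (l * conversions (\<lambda>_. m) k h
            - \<theta> k * (exp l - 1) * exposure (\<lambda>_. m) k h - c * real (pulls k h))"
          by (simp add: exposure_const \<tau>_def[symmetric] c_def algebra_simps)
        then have "1 \<le> exp (l * p * \<tau> * m + (l * conversions (\<lambda>_. m) k h
            - \<theta> k * (exp l - 1) * exposure (\<lambda>_. m) k h - c * real (pulls k h)))"
          by simp
        then show ?thesis using k by (simp only: exp_add F4_def D_def pot_def) simp
      qed
      then show ?thesis using nonneg
        by (cases "pol h = k \<and> K \<le> length h \<and> \<mu>' \<le> ucb_index \<epsilon> delay m h 1 \<and> \<not> pulls k h \<le> nat \<lfloor>x\<rfloor>")
          (auto simp: F1_def F2_def F3_def not_le)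
    qed
    have "(\<Sum>n<T. E n (\<lambda>h. of_bool (pol h = k)))
      \<le> (\<Sum>n<T. E n (\<lambda>h. F1 h + F2 h + F3 h + D * F4 h))"
      by (intro sum_mono E_mono bounded_at_of_bool bounded_at_add bounded_at_cmult bnd) (simp add: pointwise)
    also have "\<dots> = (\<Sum>n<T. E n F1 + E n F2 + E n F3 + D * E n F4)"
      by (simp add: E_add bounded_at_add bounded_at_cmult bnd)
    also have "\<dots> = (\<Sum>n<T. E n F1) + (\<Sum>n<T. E n F2) + (\<Sum>n<T. E n F3) + D * (\<Sum>n<T. E n F4)"
      by (simp add: sum.distrib sum_distrib_left)
    also have "\<dots> \<le> real K + B + (x + 1) + D * (1 / (1 - exp (- c)))"
    proof (intro add_mono mult_left_mono)
      have "(\<Sum>n<T. E n F1) = (\<Sum>n<T. of_bool (n < K))"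
      proof (intro sum.cong refl)
        fix n
        have "E n F1 = E n (\<lambda>_. of_bool (n < K))" by (intro E_cong) (simp add: F1_def)
        then show "E n F1 = of_bool (n < K)" by simp
      qed
      also have "\<dots> = real (card ({..<T} \<inter> {..<K}))" by (simp add: lessThan_def)
      also have "\<dots> \<le> real K" using card_mono[of "{..<K}" "{..<T} \<inter> {..<K}"] by simp
      finally show "(\<Sum>n<T. E n F1) \<le> real K" .
      have "(\<Sum>n<T. E n F2) \<le> C1 * (\<Sum>n<T. real (Suc n) powr - (1 + \<epsilon>))"
        unfolding sum_distrib_left F2_def by (intro sum_mono C1)
      also have "\<dots> \<le> B"
        unfolding B_def by (intro mult_left_mono sum_le_suminf summ C1_nonneg) auto
      finally show "(\<Sum>n<T. E n F2) \<le> B" .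
      have "(\<Sum>n<T. E n F3) \<le> real (nat \<lfloor>x\<rfloor>) + 1" unfolding F3_def by (rule sum_E_pulls_le)
      also have "\<dots> \<le> x + 1" using x0 by simp
      finally show "(\<Sum>n<T. E n F3) \<le> x + 1" .
      show "(\<Sum>n<T. E n F4) \<le> 1 / (1 - exp (- c))" unfolding F4_def by (rule sum_E_pot_le[OF c])
    qed (simp add: D_def)
    finally show ?thesis by (simp add: x_def)
  qed
  then show ?thesis unfolding \<tau>_def d_def by blast
qed

end

section \<open>The regret bound\<close>

theorem theorem11:
  fixes K m :: nat and \<theta> :: "nat \<Rightarrow> real" and delay :: "nat pmf"
    and \<epsilon> \<eta> :: real and pol :: "hist \<Rightarrow> nat"
  assumes K: "1 \<le> K"
    and m: "1 \<le> m"
    and theta_range: "\<forall>k\<in>{1..K}. 0 \<le> \<theta> k \<and> \<theta> k \<le> 1"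
    and theta1: "\<theta> 1 < 1"
    and gaps: "\<forall>k\<in>{2..K}. \<theta> k < \<theta> 1"
    and tau_pos: "tau delay m > 0"
    and eps: "\<epsilon> > 0"
    and eta: "\<eta> > 0"
    and alg: "is_DelayedKLUCB K \<epsilon> delay m pol"
  shows "\<exists>f :: nat \<Rightarrow> real. f \<in> o(\<lambda>T. ln (real T)) \<and>
     (\<forall>T. regret \<theta> delay m pol T \<le>
        (1 + \<eta>) * ((1 + \<epsilon>) * ln (real T) / (1 - \<theta> 1)) *
        (\<Sum>k\<in>{2..K}. tau delay m * (\<theta> 1 - \<theta> k) /
                      d_bern (tau delay m * \<theta> k) (tau delay m * \<theta> 1))
        + f T)"
proof -
  define \<tau> where "\<tau> = tau delay m"
  have \<tau>: "0 < \<tau>" "\<tau> \<le> 1" using tau_pos tau_bounds by (auto simp: \<tau>_def)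
  have pol: "pol h \<in> {1..K}" for h
    using alg by (cases "length h < K") (auto simp: is_DelayedKLUCB_def)
  interpret bandit \<theta> delay pol using pol theta_range by unfold_locales auto
  have le1: "\<theta> k \<le> \<theta> 1" if "k \<in> {1..K}" for k
    using that gaps by (cases "k = 1") (auto intro: less_imp_le)
  have arm: "\<exists>C. \<forall>T. (\<Sum>n<T. E n (\<lambda>h. of_bool (pol h = k)))
     \<le> (1 + \<eta>) * (1 + \<epsilon>) * ln (real T) / ((1 - \<theta> 1) * d_bern (\<tau> * \<theta> k) (\<tau> * \<theta> 1)) + C"
    if k: "k \<in> {2..K}" for k
  proof -
    have \<theta>k: "0 \<le> \<theta> k" "\<theta> k < \<theta> 1" using k theta_range gaps by auto
    have d0: "0 < d_pois (\<theta> k) (\<theta> 1)" using \<theta>k by (rule d_pois_pos)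
    have "d_pois (\<theta> k) (\<theta> 1) / (1 + \<eta>) < d_pois (\<theta> k) (\<theta> 1)"
      using d0 eta by (simp add: field_simps)
    \<comment> \<open>Moving the two parameters inwards costs at most the factor
      \<open>1 + \<eta>\<close> in the divergence.\<close>
    then obtain p \<mu> where p: "\<theta> k < p" "p < \<mu>" "\<mu> < \<theta> 1"
      "d_pois (\<theta> k) (\<theta> 1) / (1 + \<eta>) < d_pois p \<mu>"
      using d_pois_lower_semicontinuous \<theta>k by metis
    obtain C where C: "\<And>T. (\<Sum>n<T. E n (\<lambda>h. of_bool (pol h = k)))
        \<le> (1 + \<epsilon>) * ln (real T) / (\<tau> * d_pois p \<mu>) + C"
      using expected_pulls_le[OF m eps alg tau_pos K \<theta>k(1) p(1-3)] theta1 by (auto simp: \<tau>_def)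
    have q: "0 \<le> \<tau> * \<theta> k" "\<tau> * \<theta> k < \<tau> * \<theta> 1" "\<tau> * \<theta> 1 \<le> \<theta> 1"
      using \<tau> \<theta>k by (simp_all add: mult_left_le_one_le)
    define b where "b = d_bern (\<tau> * \<theta> k) (\<tau> * \<theta> 1)"
    have b: "0 < b" unfolding b_def using q theta1 by (intro d_bern_pos) auto
    \<comment> \<open>The factor \<open>1 / (1 - \<theta> 1)\<close> of the theorem arises here: the
      Bernoulli comparison at the scaled means gives \<open>1 - \<tau> * \<theta> 1\<close>, which
      is at least \<open>1 - \<theta> 1\<close>.\<close>
    have "(1 - \<theta> 1) * b \<le> (1 - \<tau> * \<theta> 1) * b"
      using b q by (intro mult_right_mono) auto
    also have "\<dots> \<le> \<tau> * d_pois (\<theta> k) (\<theta> 1)"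
      unfolding d_pois_scale[OF \<tau>(1), symmetric] b_def using q theta1 by (intro d_bern_le_d_pois) auto
    also have "\<dots> \<le> \<tau> * ((1 + \<eta>) * d_pois p \<mu>)"
      using p(4) \<tau> eta by (intro mult_left_mono) (auto simp: field_simps)
    finally have *: "(1 - \<theta> 1) * b \<le> (1 + \<eta>) * (\<tau> * d_pois p \<mu>)" by (simp add: mult_ac)
    have pos: "0 < (1 - \<theta> 1) * b" using b theta1 by simp
    have "(1 + \<epsilon>) * ln (real T) / (\<tau> * d_pois p \<mu>)
        \<le> (1 + \<eta>) * (1 + \<epsilon>) * ln (real T) / ((1 - \<theta> 1) * b)" for T
    proof -
      have num: "0 \<le> (1 + \<eta>) * (1 + \<epsilon>) * ln (real T)"
        using eta eps by (cases "T = 0") auto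
      have "(1 + \<epsilon>) * ln (real T) / (\<tau> * d_pois p \<mu>)
          = (1 + \<eta>) * (1 + \<epsilon>) * ln (real T) / ((1 + \<eta>) * (\<tau> * d_pois p \<mu>))"
        using eta by (simp add: mult.assoc)
      also have "\<dots> \<le> (1 + \<eta>) * (1 + \<epsilon>) * ln (real T) / ((1 - \<theta> 1) * b)"
        by (intro divide_left_mono[OF *] num mult_pos_pos pos less_le_trans[OF pos *])
      finally show ?thesis .
    qed
    then show ?thesis using C unfolding b_def by (meson add_right_mono order_trans)
  qed
  then obtain C where C: "\<And>k T. k \<in> {2..K} \<Longrightarrow> (\<Sum>n<T. E n (\<lambda>h. of_bool (pol h = k)))
     \<le> (1 + \<eta>) * (1 + \<epsilon>) * ln (real T) / ((1 - \<theta> 1) * d_bern (\<tau> * \<theta> k) (\<tau> * \<theta> 1)) + C k"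
    by metis
  define c where "c = (\<Sum>k\<in>{2..K}. \<tau> * (\<theta> 1 - \<theta> k) * C k)"
  have gap: "\<theta> 1 - \<theta> (pol h) = (\<Sum>k\<in>{2..K}. (\<theta> 1 - \<theta> k) * of_bool (pol h = k))" for h
  proof -
    \<comment> \<open>Arm 1 may be added because its gap is zero; the enlarged sum then selects the
      single arm played.\<close>
    have "(\<Sum>k\<in>{2..K}. (\<theta> 1 - \<theta> k) * of_bool (pol h = k))
        = (\<Sum>k\<in>{1..K}. if k = pol h then \<theta> 1 - \<theta> k else 0)"
      by (intro sum.mono_neutral_cong_left) (auto simp: not_le less_Suc_eq_le numeral_2_eq_2)
    then show ?thesis using pol[of h] by simp
  qed
  have "regret \<theta> delay m pol T \<le> (1 + \<eta>) * ((1 + \<epsilon>) * ln (real T) / (1 - \<theta> 1)) *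
      (\<Sum>k\<in>{2..K}. \<tau> * (\<theta> 1 - \<theta> k) / d_bern (\<tau> * \<theta> k) (\<tau> * \<theta> 1)) + c" for T
  proof -
    have "regret \<theta> delay m pol T \<le> \<tau> * (\<Sum>n<T. E n (\<lambda>h. \<theta> 1 - \<theta> (pol h)))"
      unfolding \<tau>_def using theta_range K le1 pol by (intro regret_le) auto
    also have "\<dots> = \<tau> * (\<Sum>n<T. \<Sum>k\<in>{2..K}. (\<theta> 1 - \<theta> k) * E n (\<lambda>h. of_bool (pol h = k)))"
      unfolding gap by (subst E_sum) (auto intro!: bounded_at_cmult bounded_at_of_bool)
    also have "\<dots> = (\<Sum>k\<in>{2..K}. \<tau> * (\<theta> 1 - \<theta> k) * (\<Sum>n<T. E n (\<lambda>h. of_bool (pol h = k))))"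
      by (subst sum.swap) (simp add: sum_distrib_left mult.assoc)
    also have "\<dots> \<le> (\<Sum>k\<in>{2..K}. \<tau> * (\<theta> 1 - \<theta> k) *
        ((1 + \<eta>) * (1 + \<epsilon>) * ln (real T) / ((1 - \<theta> 1) * d_bern (\<tau> * \<theta> k) (\<tau> * \<theta> 1)) + C k))"
      using \<tau> le1 by (intro sum_mono mult_left_mono C) auto
    also have "\<dots> = (1 + \<eta>) * ((1 + \<epsilon>) * ln (real T) / (1 - \<theta> 1)) *
      (\<Sum>k\<in>{2..K}. \<tau> * (\<theta> 1 - \<theta> k) / d_bern (\<tau> * \<theta> k) (\<tau> * \<theta> 1)) + c"
      unfolding sum_distrib_left c_def sum.distrib[symmetric]
      by (intro sum.cong refl, subst distrib_left) (simp add: mult_ac)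
    finally show ?thesis .
  qed
  \<comment> \<open>The remainder is a constant.\<close>
  moreover have "(\<lambda>_. c) \<in> o(\<lambda>T::nat. ln (real T))" by real_asymp
  ultimately show ?thesis unfolding \<tau>_def by blast
qed

end
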